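(* Let $q$ be an odd prime. Then the automaticity $A(x)$ in base $q$ of the set of perfect squares satisfies $A(x)\asymp x^{1/2}$, i.e. there are constants $0<c_1\le c_2$ (possibly depending on $q$) with $c_1x^{1/2}\le A(x)\le c_2x^{1/2}$ for all sufficiently large $x$.
   Context: A finite automaton over an alphabet $\mathcal{A}$ consists of a finite set $S$ of states, a starting state $s_0\in S$, a transition function $\delta:\mathcal{A}\times S\to S$ and a set $T\subseteq S$ of accepting states; a word $a_1\cdots a_n$ induces states $s_0,\dots,s_n$ with $s_{i+1}=\delta(a_{i+1},s_i)$ and is accepted iff $s_n\in T$. With $\mathcal{A}=\{0,1,\dots,q-1\}$, words are identified with nonnegative integers via the base-$q$ representation (in the paper's arguments the digits are read starting from the least significant digit). The ($q$-)automaticity of a set $\mathcal{X}$ of positive integers is the function $A(x)$ giving, for each $x$, the number of states of the smallest automaton which, for every integer $1\le n\le x$, accepts the base-$q$ representation of $n$ if and only if $n\in\mathcal{X}$. *)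

theory Defs
  imports Complex_Main "HOL-Computational_Algebra.Nth_Powers"
begin

record 's automaton =
  states :: "'s set"
  start :: 's
  delta :: "nat \<Rightarrow> 's \<Rightarrow> 's"
  accepting :: "'s set"

definition finite_automaton :: "nat \<Rightarrow> ('s, 'b) automaton_scheme \<Rightarrow> bool" where
  "finite_automaton q M \<longleftrightarrow>
     finite (states M) \<and> start M \<in> states M \<and> accepting M \<subseteq> states M \<and>
     (\<forall>a<q. \<forall>s\<in>states M. delta M a s \<in> states M)"

definition accepts :: "('s, 'b) automaton_scheme \<Rightarrow> nat list \<Rightarrow> bool" where
  "accepts M w \<longleftrightarrow> fold (delta M) w (start M) \<in> accepting M"

text \<open>The head of the list is the least significant digit, so that automata read
  the digits of a number from the least significant one upwards. There are no superfluous
  zeros at the most significant end. For \<open>q < 2\<close> the value is a dummy.\<close>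

function base_digits :: "nat \<Rightarrow> nat \<Rightarrow> nat list" where
  "base_digits q n = (if q < 2 \<or> n = 0 then [] else (n mod q) # base_digits q (n div q))"
  by auto
termination by (relation "measure snd") auto

declare base_digits.simps [simp del]

lemma horner_sum_base_digits:
  assumes "q \<ge> 2"
  shows "horner_sum (\<lambda>d. d) q (base_digits q n) = n"
proof (induction n rule: less_induct)
  case (less n)
  then show ?case using assms by (subst base_digits.simps) auto
qed

lemma set_base_digits: "set (base_digits q n) \<subseteq> {..<q}"
proof (induction n rule: less_induct)
  case (less n)
  then show ?case by (subst base_digits.simps) auto
qed

lemma last_base_digits:
  assumes "q \<ge> 2" "n > 0"
  shows "base_digits q n \<noteq> [] \<and> last (base_digits q n) \<noteq> 0"
  using assms(2)
proof (induction n rule: less_induct)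
  case (less n)
  show ?case
  proof (cases "n div q = 0")
    case True
    then have "n < q" using assms by (simp add: div_eq_0_iff)
    then have "base_digits q n = [n]"
      using assms less.prems by (simp add: base_digits.simps[of q n] base_digits.simps[of q 0])
    then show ?thesis using less.prems by simp
  next
    case False
    then have "base_digits q (n div q) \<noteq> [] \<and> last (base_digits q (n div q)) \<noteq> 0"
      using less assms by simp
    then show ?thesis
      using assms less.prems by (simp add: base_digits.simps[of q n])
  qed
qed

definition recognizes_upto ::
    "nat \<Rightarrow> ('s, 'b) automaton_scheme \<Rightarrow> nat set \<Rightarrow> real \<Rightarrow> bool" where
  "recognizes_upto q M X x \<longleftrightarrow>
     (\<forall>n::nat. 1 \<le> n \<and> real n \<le> x \<longrightarrow> (accepts M (base_digits q n) \<longleftrightarrow> n \<in> X))"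

text \<open>States are natural numbers here, which is no restriction: see
  \<open>automaticity_le\<close> below. The minimum is attained by \<open>automaticity_attained\<close>.\<close>

definition automaticity :: "nat \<Rightarrow> nat set \<Rightarrow> real \<Rightarrow> nat" where
  "automaticity q X x =
     (LEAST k. \<exists>M :: nat automaton.
        finite_automaton q M \<and> card (states M) = k \<and> recognizes_upto q M X x)"

lemma rename_states:
  fixes M :: "'s automaton"
  assumes fin: "finite_automaton q M" and rec: "recognizes_upto q M X x"
  obtains M' :: "nat automaton" where
    "finite_automaton q M'" "card (states M') = card (states M)" "recognizes_upto q M' X x"
proof -
  have finS: "finite (states M)" using fin by (simp add: finite_automaton_def)
  then obtain f :: "'s \<Rightarrow> nat" where inj: "inj_on f (states M)"
    using finite_imp_inj_to_nat_seg by blast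
  define g where "g = the_inv_into (states M) f"
  have g: "g (f s) = s" if "s \<in> states M" for s
    using that inj by (simp add: g_def the_inv_into_f_f)
  define M' :: "nat automaton" where
    "M' = \<lparr>states = f ` states M, start = f (start M),
           delta = (\<lambda>a k. f (delta M a (g k))), accepting = f ` accepting M\<rparr>"
  have fold: "fold (delta M') w (f s) = f (fold (delta M) w s) \<and> fold (delta M) w s \<in> states M"
    if "set w \<subseteq> {..<q}" "s \<in> states M" for w s
    using that
  proof (induction w arbitrary: s)
    case (Cons a w)
    then have "delta M a s \<in> states M" using fin by (simp add: finite_automaton_def)
    then show ?case using Cons g by (simp add: M'_def)
  qed simp
  have acc: "accepts M' w \<longleftrightarrow> accepts M w" if "set w \<subseteq> {..<q}" for w
  proof -
    have s: "start M \<in> states M" and A: "accepting M \<subseteq> states M"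
      using fin by (auto simp: finite_automaton_def)
    have "accepts M' w \<longleftrightarrow> f (fold (delta M) w (start M)) \<in> f ` accepting M"
      using fold[OF that s] by (simp add: accepts_def M'_def)
    also have "\<dots> \<longleftrightarrow> accepts M w"
      using fold[OF that s] A inj by (auto simp: accepts_def dest: inj_onD)
    finally show ?thesis .
  qed
  have "finite_automaton q M'"
    using fin by (auto simp: finite_automaton_def M'_def g)
  moreover have "card (states M') = card (states M)"
    using inj by (simp add: M'_def card_image)
  moreover have "recognizes_upto q M' X x"
    using rec acc[OF set_base_digits] by (simp add: recognizes_upto_def)
  ultimately show ?thesis using that by blast
qed

lemma automaticity_le:
  fixes M :: "'s automaton"
  assumes "finite_automaton q M" "recognizes_upto q M X x"
  shows "automaticity q X x \<le> card (states M)"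
  unfolding automaticity_def
  by (rule rename_states[OF assms], rule Least_le) blast

lemma automaticity_attained:
  assumes q: "q \<ge> 2"
  obtains M :: "nat automaton" where
    "finite_automaton q M" "card (states M) = automaticity q X x" "recognizes_upto q M X x"
proof -
  define N where "N = nat \<lfloor>x\<rfloor>"
  define L where "L = Max ((length \<circ> base_digits q) ` {..N})"
  have L: "length (base_digits q n) \<le> L" if "n \<le> N" for n
    using that by (auto simp: L_def)
  define S where "S = {w. set w \<subseteq> {..<q} \<and> length w \<le> L}"
  define M :: "nat list automaton" where
    "M = \<lparr>states = S, start = [], delta = (\<lambda>a w. if length w < L then w @ [a] else w),
          accepting = S \<inter> base_digits q ` X\<rparr>"
  have fold: "fold (delta M) w v = v @ w" if "length v + length w \<le> L" for w v
    using that by (induction w arbitrary: v) (auto simp: M_def)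
  have "finite_automaton q M"
    using finite_lists_length_le[of "{..<q}" L] by (auto simp: finite_automaton_def M_def S_def)
  moreover have "recognizes_upto q M X x"
    unfolding recognizes_upto_def
  proof (intro allI impI)
    fix n :: nat
    assume "1 \<le> n \<and> real n \<le> x"
    then have "n \<le> N" unfolding N_def by linarith
    then have len: "length (base_digits q n) \<le> L" by (rule L)
    have "accepts M (base_digits q n) \<longleftrightarrow> base_digits q n \<in> base_digits q ` X"
      using fold[of "[]" "base_digits q n"] len set_base_digits[of q n]
      by (simp add: accepts_def M_def S_def)
    also have "\<dots> \<longleftrightarrow> n \<in> X"
      by (metis horner_sum_base_digits[OF q] image_iff)
    finally show "accepts M (base_digits q n) \<longleftrightarrow> n \<in> X" .
  qed
  ultimately obtain M' :: "nat automaton" where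
    "finite_automaton q M'" "card (states M') = card (states M)" "recognizes_upto q M' X x"
    by (rule rename_states)
  then have "\<exists>k. \<exists>M :: nat automaton.
      finite_automaton q M \<and> card (states M) = k \<and> recognizes_upto q M X x"
    by blast
  from LeastI_ex[OF this] show ?thesis
    using that unfolding automaticity_def by blast
qed

end

theory Submission
  imports Defs
begin

text \<open>
  Lower bound: let \<open>q\<^sup>2\<^sup>l \<le> x\<close>. For \<open>r\<close> in the upper half of \<open>{0..<q\<^sup>l}\<close>, consecutive squares near
  \<open>r\<^sup>2\<close> are at least \<open>q\<^sup>l\<close> apart, so replacing the lowest \<open>l\<close> digits of \<open>r\<^sup>2\<close> by different ones
  never yields a square. Hence the automaton must reach different states for different values of
  \<open>r\<^sup>2\<close> modulo \<open>q\<^sup>l\<close>, and these are distinct when \<open>r\<close> runs over the numbers congruent to \<open>1\<close>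
  modulo \<open>q\<close>.

  Upper bound: let \<open>x < q\<^sup>2\<^sup>L\<close>. As states take the sets of those \<open>m\<close> for which
  \<open>a + q\<^sup>k m\<close> is a square below \<open>q\<^sup>2\<^sup>L\<close>. There are \<open>O(q\<^sup>L)\<close> of them with \<open>k \<le> L\<close>. If \<open>k > L\<close>, the
  sets with at most one element are \<open>{}\<close> and \<open>{m}\<close> with \<open>m < q\<^sup>L\<close>, while a set with two elements
  comes from squares \<open>r\<^sup>2\<close> and \<open>s\<^sup>2\<close> congruent modulo \<open>q\<^sup>k\<close> with \<open>r < s < q\<^sup>L\<close>. Neither \<open>s - r\<close> nor
  \<open>s + r\<close> is divisible by \<open>q\<^sup>L\<^sup>+\<^sup>1\<close>, so both are divisible by \<open>q\<^sup>k\<^sup>-\<^sup>L\<close>, hence so is \<open>s\<close>, which leaves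
  at most \<open>q\<^sup>2\<^sup>L\<^sup>-\<^sup>k\<close> sets.
\<close>

section \<open>Low digits of a number and the runs of an automaton on them\<close>

primrec low_digits :: "nat \<Rightarrow> nat \<Rightarrow> nat \<Rightarrow> nat list" where
  "low_digits q 0 n = []"
| "low_digits q (Suc l) n = n mod q # low_digits q l (n div q)"

lemma set_low_digits: "q > 0 \<Longrightarrow> set (low_digits q l n) \<subseteq> {..<q}"
  by (induction l arbitrary: n) auto

lemma low_digits_mod: "q > 0 \<Longrightarrow> low_digits q l (n mod q ^ l) = low_digits q l n"
proof (induction l arbitrary: n)
  case (Suc l)
  have "n mod q ^ Suc l = q * (n div q mod q ^ l) + n mod q"
    by (simp add: mod_mult2_eq)
  then have "n mod q ^ Suc l mod q = n mod q" "n mod q ^ Suc l div q = n div q mod q ^ l"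
    using Suc.prems by simp_all
  then show ?case
    using Suc by (simp del: power_Suc)
qed simp

text \<open>\<open>low_digits\<close> pads with zeros to length exactly \<open>l\<close>, whereas
  \<open>base_digits\<close> has no leading zeros. The two fit together because
  \<open>q ^ l \<le> n\<close> makes the quotient nonzero.\<close>

lemma base_digits_split:
  assumes "q \<ge> 2" "q ^ l \<le> n"
  shows "base_digits q n = low_digits q l n @ base_digits q (n div q ^ l)"
  using assms(2)
proof (induction l arbitrary: n)
  case (Suc l)
  have "q ^ l \<le> n div q"
    using Suc.prems assms(1) by (simp add: less_eq_div_iff_mult_less_eq mult.commute)
  moreover have "n > 0"
    using Suc.prems assms(1) by (auto intro: Nat.gr0I)
  ultimately show ?case
    using Suc.IH[of "n div q"] assms(1)
    by (simp add: base_digits.simps[of q n] div_mult2_eq)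
qed simp

lemma fold_delta_in_states:
  assumes "finite_automaton q M" "set w \<subseteq> {..<q}" "s \<in> states M"
  shows "fold (delta M) w s \<in> states M"
  using assms(2,3)
proof (induction w arbitrary: s)
  case (Cons a w)
  then show ?case using assms(1) by (simp add: finite_automaton_def)
qed simp

text \<open>If the low digits of \<open>f r\<close> and \<open>f s\<close> led to the same state,
  appending the high digits of \<open>f r\<close> to both would give two numbers with the same
  verdict, although only \<open>f r\<close> lies in \<open>X\<close>. Hence different elements of
  \<open>R\<close> reach different states.\<close>

lemma card_states_ge_injective_prefixes:
  fixes f :: "nat \<Rightarrow> nat"
  assumes q: "q \<ge> 2" and fin: "finite_automaton q M" and rec: "recognizes_upto q M X x"
    and sep: "\<And>r s. r \<in> R \<Longrightarrow> s \<in> R \<Longrightarrow> r \<noteq> s \<Longrightarrow>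
      q ^ l \<le> f r \<and> f r \<in> X \<and> f s mod q ^ l + q ^ l * (f r div q ^ l) \<notin> X"
    and le: "\<And>r. r \<in> R \<Longrightarrow> f r < q ^ k" and lk: "l \<le> k" and x: "real q ^ k \<le> x"
  shows "card R \<le> card (states M)"
proof (rule card_inj_on_le)
  define g where "g = (\<lambda>r. fold (delta M) (low_digits q l (f r)) (start M))"
  show "g ` R \<subseteq> states M"
    using fin set_low_digits[of q] q
    by (auto simp: g_def finite_automaton_def intro!: fold_delta_in_states[OF fin])
  show "finite (states M)"
    using fin by (simp add: finite_automaton_def)
  have acc: "accepts M (base_digits q n) \<longleftrightarrow> n \<in> X" if "0 < n" "n < q ^ k" for n
  proof -
    have "real n \<le> real (q ^ k)"
      using that(2) by (subst of_nat_le_iff) simp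
    then have "real n \<le> x"
      using x unfolding of_nat_power by linarith
    then show ?thesis
      using rec that(1) by (simp add: recognizes_upto_def)
  qed
  show "inj_on g R"
  proof (rule inj_onI, rule ccontr)
    fix r s
    assume rs: "r \<in> R" "s \<in> R" "g r = g s" "r \<noteq> s"
    define m where "m = f r div q ^ l"
    define n where "n = f s mod q ^ l + q ^ l * m"
    have ql: "q ^ l > 0" using q by simp
    have sep': "q ^ l \<le> f r" "f r \<in> X" "n \<notin> X"
      using sep[OF rs(1,2,4)] by (auto simp: n_def m_def)
    have m0: "m > 0"
      using sep'(1) ql by (simp add: m_def div_greater_zero_iff)
    \<comment> \<open>A nonzero high part lets \<open>base_digits_split\<close> apply to the hybrid
      number \<open>n\<close>.\<close>
    have n_ge: "q ^ l \<le> n"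
      using m0 by (simp add: n_def trans_le_add2)
    have n_div: "n div q ^ l = m" and n_mod: "n mod q ^ l = f s mod q ^ l"
      using ql by (simp_all add: n_def)
    have m_less: "m < q ^ (k - l)"
      using le[OF rs(1)] lk ql
      by (simp add: m_def div_less_iff_less_mult flip: power_add)
    have "n < q ^ l * (m + 1)"
      using ql by (simp add: n_def)
    also have "\<dots> \<le> q ^ l * q ^ (k - l)"
      using m_less by (intro mult_le_mono) simp_all
    also have "\<dots> = q ^ k"
      using lk by (simp flip: power_add)
    finally have n_less: "n < q ^ k" .
    have low: "low_digits q l n = low_digits q l (f s)"
      using low_digits_mod[of q l n] low_digits_mod[of q l "f s"] n_mod q by simp
    have "accepts M (base_digits q n) \<longleftrightarrow> accepts M (base_digits q (f r))"
      using rs(3) base_digits_split[OF q n_ge] base_digits_split[OF q sep'(1)] low n_div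
      by (simp add: accepts_def g_def m_def)
    moreover have "n > 0" "f r > 0"
      using n_ge sep'(1) ql by linarith+
    ultimately have "n \<in> X \<longleftrightarrow> f r \<in> X"
      using acc n_less le[OF rs(1)] by simp
    then show False
      using sep' by simp
  qed
qed

section \<open>Lower bound for the squares\<close>

text \<open>The squares next to \<open>r ^ 2\<close> lie at distance at least
  \<open>2 * r - 1\<close>, which is at least \<open>N\<close>.\<close>

lemma square_gap:
  fixes r t N :: nat
  assumes "r ^ 2 < t ^ 2 + N" "t ^ 2 < r ^ 2 + N" "N < 2 * r"
  shows "t = r"
proof (rule ccontr)
  assume "t \<noteq> r"
  then consider "t + 1 \<le> r" | "r + 1 \<le> t" by linarith
  then show False
  proof cases
    case 1
    then obtain d where r: "r = t + 1 + d" using le_Suc_ex by blast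
    have "t ^ 2 + (2 * r - 1) \<le> r ^ 2"
      unfolding r by (simp add: power2_eq_square algebra_simps)
    then show False using assms by linarith
  next
    case 2
    then have "(r + 1) ^ 2 \<le> t ^ 2" by (rule power_mono) simp
    then show False using assms by (simp add: power2_eq_square)
  qed
qed

text \<open>Since \<open>r + s\<close> is 2 modulo the odd number \<open>q\<close>, it is coprime to
  \<open>q\<close>. So if \<open>q ^ l\<close> divides \<open>(r + s) * (r - s)\<close>, it divides
  \<open>r - s\<close>.\<close>

lemma square_mod_inj:
  fixes q r s :: nat
  assumes "odd q" "r mod q = 1" "s mod q = 1" "r < q ^ l" "s < q ^ l"
    and eq: "r ^ 2 mod q ^ l = s ^ 2 mod q ^ l"
  shows "r = s"
proof -
  have "(r + s) mod q = 2 mod q"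
    using assms(2,3) by (metis mod_add_eq one_add_one)
  then have "gcd (r + s) q = gcd 2 q"
    by (metis gcd.commute gcd_red_nat)
  then have "coprime (r + s) q"
    using assms(1) by (simp add: coprime_iff_gcd_eq_1 flip: coprime_left_2_iff_odd)
  then have cop: "coprime (int q ^ l) (int r + int s)"
    by (metis coprime_commute coprime_int_iff coprime_power_right_iff of_nat_add)
  have "int r ^ 2 mod int q ^ l = int s ^ 2 mod int q ^ l"
    using eq by (metis of_nat_mod of_nat_power)
  then have "int q ^ l dvd (int r + int s) * (int r - int s)"
    by (simp add: mod_eq_dvd_iff power2_eq_square algebra_simps)
  then have "int q ^ l dvd int r - int s"
    using cop by (simp add: coprime_dvd_mult_right_iff)
  then have "int r mod int q ^ l = int s mod int q ^ l"
    by (simp add: mod_eq_dvd_iff)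
  then show ?thesis
    using assms(4,5) by (metis mod_less of_nat_eq_iff of_nat_mod of_nat_power)
qed

lemma automaticity_squares_ge:
  fixes q l :: nat
  assumes "odd q" "q \<ge> 3" and x: "real q ^ (2 * (l + 2)) \<le> x"
  shows "q ^ (l + 1) \<le> 3 * automaticity q {n. 0 < n \<and> is_square n} x"
proof -
  have q2: "q \<ge> 2" using assms(2) by simp
  define X where "X = {n::nat. 0 < n \<and> is_square n}"
  define P where "P = q ^ (l + 1)"
  define N where "N = q ^ (l + 2)"
  have NP: "N = q * P" by (simp add: N_def P_def)
  have P_ge: "P \<ge> 3"
    using assms(2) self_le_power[of q "l + 1"] unfolding P_def by linarith
  have "odd P" using assms(1) by (simp add: P_def)
  then obtain h where h: "P = 2 * h + 1" by (auto elim: oddE)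
  \<comment> \<open>For these \<open>j\<close>, the number \<open>q * j + 1\<close> lies in the
    upper half of the range below \<open>N\<close>. There are \<open>h\<close> of them, and
    \<open>P \<le> 3 * h\<close> because \<open>P \<ge> 3\<close>.\<close>
  define J where "J = {h + 1..<P}"
  define f where "f = (\<lambda>j. (q * j + 1) ^ 2)"
  have low: "N < 2 * (q * j + 1)" if "j \<in> J" for j
  proof -
    have "q * P \<le> q * (2 * j)" using that by (intro mult_le_mono) (auto simp: J_def h)
    also have "\<dots> < 2 * (q * j + 1)" by simp
    finally show ?thesis by (simp only: NP)
  qed
  have high: "q * j + 1 < N" if "j \<in> J" for j
  proof -
    have "q * (j + 1) \<le> q * P" using that by (intro mult_le_mono) (auto simp: J_def)
    then show ?thesis using assms(2) by (simp add: NP)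
  qed
  obtain M :: "nat automaton" where M: "finite_automaton q M"
    "card (states M) = automaticity q X x" "recognizes_upto q M X x"
    using automaticity_attained[OF q2] .
  have "card J \<le> card (states M)"
  proof (rule card_states_ge_injective_prefixes[OF q2 M(1,3),
        where f = f and l = "l + 2" and k = "2 * (l + 2)"])
    show "f r < q ^ (2 * (l + 2))" if "r \<in> J" for r
    proof -
      have "(q * r + 1) ^ 2 < N ^ 2" using high[OF that] by (intro power_strict_mono) simp_all
      also have "N ^ 2 = q ^ (2 * (l + 2))"
        by (simp only: N_def mult.commute[of 2] power_mult)
      finally show ?thesis by (simp add: f_def)
    qed
    fix i j
    assume ij: "i \<in> J" "j \<in> J" "i \<noteq> j"
    define n where "n = f j mod N + N * (f i div N)"
    have N_pos: "N > 0" using q2 by (simp add: N_def)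
    have "N \<le> f i"
    proof -
      define p where "p = q * i + 1"
      have N_less: "N < 2 * p" using low[OF ij(1)] by (simp only: p_def)
      have "N \<ge> 9" using P_ge assms(2) mult_le_mono[of 3 q 3 P] by (simp add: NP)
      then have "2 \<le> p" using N_less by linarith
      then have "2 * p \<le> p * p" by (rule mult_le_mono1)
      with N_less have "N < p * p" by (rule less_le_trans)
      then have "N \<le> p ^ 2" by (simp add: power2_eq_square)
      then show ?thesis by (simp only: f_def p_def)
    qed
    moreover have "f i \<in> X"
      by (simp add: X_def f_def)
    moreover have "n \<notin> X"
    proof
      assume "n \<in> X"
      then obtain t where t: "n = t ^ 2" by (auto simp: X_def elim: is_nth_powerE)
      \<comment> \<open>\<open>n\<close> and \<open>f i\<close> share the same multiple of
        \<open>N\<close>, so they differ by less than \<open>N\<close> and \<open>square_gap\<close>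
        applies.\<close>
      have "f i = f i mod N + N * (f i div N)" by simp
      moreover have "f i mod N < N" "f j mod N < N" using N_pos by simp_all
      ultimately have "f i < n + N" "n < f i + N" unfolding n_def by linarith+
      then have "t = q * i + 1"
        using square_gap low[OF ij(1)] by (simp add: f_def t)
      then have "n = f i" by (simp add: t f_def)
      then have "f i mod N = f j mod N"
        by (metis mod_mult_self2 mod_mod_trivial n_def)
      then have "(q * i + 1) ^ 2 mod q ^ (l + 2) = (q * j + 1) ^ 2 mod q ^ (l + 2)"
        by (simp only: f_def N_def)
      moreover have "(q * i + 1) mod q = 1" "(q * j + 1) mod q = 1"
        using assms(2) by (simp_all only: mod_mult_self4 mod_less)
      ultimately have "q * i + 1 = q * j + 1"
        using square_mod_inj[OF assms(1)] high[OF ij(1)] high[OF ij(2)] unfolding N_def by blast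
      then show False using ij(3) assms(2) by simp
    qed
    ultimately show "q ^ (l + 2) \<le> f i \<and> f i \<in> X \<and>
        f j mod q ^ (l + 2) + q ^ (l + 2) * (f i div q ^ (l + 2)) \<notin> X"
      unfolding N_def n_def by blast
  qed (use x in simp_all)
  moreover have "card J = h" by (simp add: J_def h)
  ultimately have "P \<le> 3 * automaticity q X x"
    using P_ge h M(2) by linarith
  then show ?thesis by (simp only: P_def X_def)
qed

section \<open>Upper bound by counting residual sets\<close>

text \<open>A Myhill-Nerode residual: \<open>a\<close> is the value of the \<open>k\<close> digits
  already read, \<open>m\<close> that of the digits still to come.\<close>

definition residual :: "nat \<Rightarrow> nat set \<Rightarrow> nat \<Rightarrow> nat \<Rightarrow> nat set" where
  "residual q X k a = {m. a + q ^ k * m \<in> X}"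

text \<open>The residuals of \<open>Y\<close> themselves serve as states. A state accepts iff it
  contains 0, the value of the empty rest. Agreement of \<open>X\<close> and \<open>Y\<close> up to
  \<open>x\<close> suffices, so \<open>Y\<close> may be a finite truncation.\<close>

lemma automaticity_le_card_residuals:
  assumes q: "q \<ge> 2"
    and sub: "\<And>k a. a < q ^ k \<Longrightarrow> residual q Y k a \<in> T" and fin: "finite T"
    and eq: "\<And>n. 1 \<le> n \<Longrightarrow> real n \<le> x \<Longrightarrow> n \<in> X \<longleftrightarrow> n \<in> Y"
  shows "automaticity q X x \<le> card T"
proof -
  define S where "S = {residual q Y k a | k a. a < q ^ k}"
  have S: "S \<subseteq> T" using sub by (auto simp: S_def)
  define M :: "nat set automaton" where
    "M = \<lparr>states = S, start = Y, delta = (\<lambda>d F. {m. d + q * m \<in> F}),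
          accepting = {F \<in> S. 0 \<in> F}\<rparr>"
  have Y: "Y \<in> S"
    unfolding S_def by (rule CollectI, rule exI[of _ 0]) (simp add: residual_def)
  have step: "{m. d + q * m \<in> F} \<in> S" if d: "d < q" and F: "F \<in> S" for d F
  proof -
    obtain k a where ka: "a < q ^ k" "F = residual q Y k a"
      using F by (auto simp: S_def)
    have "a + q ^ k * d < q ^ k * (d + 1)" using ka by simp
    also have "\<dots> \<le> q ^ k * q" using d by (intro mult_le_mono) simp_all
    finally have "a + q ^ k * d < q ^ Suc k" by (simp add: mult.commute)
    \<comment> \<open>The digit read after \<open>k\<close> others has weight
      \<open>q ^ k\<close>.\<close>
    moreover have "{m. d + q * m \<in> F} = residual q Y (Suc k) (a + q ^ k * d)"
      by (simp add: ka residual_def algebra_simps)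
    ultimately show ?thesis unfolding S_def by blast
  qed
  have fa: "finite_automaton q M"
    using Y step finite_subset[OF S fin] by (auto simp: finite_automaton_def M_def)
  have fold: "0 \<in> fold (delta M) (base_digits q n) F \<longleftrightarrow> n \<in> F" for n F
  proof (induction n arbitrary: F rule: less_induct)
    case (less n)
    show ?case
    proof (cases "n = 0")
      case True
      then show ?thesis by (simp add: base_digits.simps)
    next
      case False
      then show ?thesis
        using q less[of "n div q"] by (subst base_digits.simps) (simp add: M_def)
    qed
  qed
  have "recognizes_upto q M X x"
  proof -
    have "accepts M (base_digits q n) \<longleftrightarrow> n \<in> Y" for n
      using fold[of n Y] fold_delta_in_states[OF fa set_base_digits, of "start M" n] Y
      by (simp add: accepts_def M_def)
    then show ?thesis using eq by (simp add: recognizes_upto_def)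
  qed
  then have "automaticity q X x \<le> card (states M)"
    by (rule automaticity_le[OF fa])
  also have "\<dots> \<le> card T" using card_mono[OF fin S] by (simp add: M_def)
  finally show ?thesis .
qed

lemma card_UN_powers_le:
  fixes f :: "nat \<Rightarrow> nat \<Rightarrow> 'a"
  assumes "q \<ge> 2"
  shows "card (\<Union>i\<le>L. f i ` {..<q ^ i}) \<le> 2 * q ^ L"
proof -
  have "card (\<Union>i\<le>L. f i ` {..<q ^ i}) \<le> (\<Sum>i\<le>L. card (f i ` {..<q ^ i}))"
    by (rule card_UN_le) simp
  also have "\<dots> \<le> (\<Sum>i\<le>L. q ^ i)"
    by (rule sum_mono) (metis card_image_le card_lessThan finite_lessThan)
  also have "\<dots> \<le> 2 * q ^ L"
  proof (induction L)
    case (Suc L)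
    have "2 * q ^ L \<le> q * q ^ L" using assms by (rule mult_le_mono1)
    then show ?case
      unfolding sum.atMost_Suc power_Suc using Suc by linarith
  qed simp
  finally show ?thesis .
qed

section \<open>Residuals of the set of squares\<close>

text \<open>The exponents of \<open>q\<close> in \<open>s + r\<close> and \<open>s - r\<close> add
  up to at least \<open>k\<close> and are at most \<open>L\<close> each, so both are at least
  \<open>k - L\<close>. The sum of the two numbers is \<open>2 * s\<close>, and the factor 2 is
  coprime to \<open>q\<close>.\<close>

lemma congruent_squares_dvd:
  fixes q r s :: nat
  assumes "prime q" "odd q" "r < s" "s < q ^ L" "L \<le> k"
    and dvd: "q ^ k dvd s ^ 2 - r ^ 2"
  shows "q ^ (k - L) dvd s"
proof -
  define i j where "i = multiplicity q (s + r)" and "j = multiplicity q (s - r)"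
  have q3: "q \<ge> 3"
    using assms(1,2) prime_ge_2_nat[of q] by (cases "q = 2") auto
  have mult_le: "multiplicity q t \<le> L" if "0 < t" "t < q ^ (L + 1)" for t
  proof -
    have "q ^ multiplicity q t \<le> t"
      using that(1) by (intro dvd_imp_le multiplicity_dvd)
    then have "q ^ multiplicity q t < q ^ (L + 1)" using that(2) by linarith
    then have "multiplicity q t < L + 1"
      by (rule power_less_imp_less_exp[rotated]) (use q3 in simp)
    then show ?thesis by simp
  qed
  have "2 * q ^ L \<le> q * q ^ L" using q3 by (intro mult_le_mono1) simp
  then have "s + r < q ^ (L + 1)" "s - r < q ^ (L + 1)"
    using assms(3,4) by (simp_all, linarith+)
  then have ij: "i \<le> L" "j \<le> L"
    using mult_le assms(3) by (simp_all add: i_def j_def)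
  obtain d where "s = r + d" using assms(3) less_imp_add_positive by blast
  then have "s ^ 2 - r ^ 2 = (s + r) * (s - r)"
    by (simp add: power2_eq_square algebra_simps)
  then have "k \<le> multiplicity q ((s + r) * (s - r))"
    using dvd assms(1,3) by (intro multiplicity_geI) auto
  also have "\<dots> = i + j"
    using assms(1,3) by (simp add: i_def j_def prime_elem_multiplicity_mult_distrib)
  finally have "k - L \<le> i" "k - L \<le> j" using ij by linarith+
  then have "q ^ (k - L) dvd s + r" "q ^ (k - L) dvd s - r"
    by (auto simp: i_def j_def intro: multiplicity_dvd')
  then have "q ^ (k - L) dvd (s + r) + (s - r)" by (rule dvd_add)
  also have "(s + r) + (s - r) = 2 * s" using assms(3) by simp
  finally show ?thesis
    using assms(2) by (subst (asm) coprime_dvd_mult_right_iff) simp_all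
qed

text \<open>In the last case the residual is determined by \<open>i\<close> and \<open>u\<close>
  alone, so such residuals can be counted by the pairs with \<open>u < q ^ i\<close>.\<close>

lemma residual_squares_cases:
  fixes q L k a :: nat
  defines "Y \<equiv> {n. is_square n \<and> n < q ^ (2 * L)}"
  assumes q: "prime q" "odd q" and Lk: "L < k" and a: "a < q ^ k"
  obtains "residual q Y k a = {}"
  | m where "m < q ^ L" "residual q Y k a = {m}"
  | i u where "i \<le> L" "u < q ^ i"
      "residual q Y k a = residual q Y (2 * L - i) ((q ^ (L - i) * u) ^ 2 mod q ^ (2 * L - i))"
proof -
  let ?F = "residual q Y k a"
  have q_pos: "q > 0" using q(1) prime_gt_0_nat by blast
  have elem: "m < q ^ L" if "m \<in> ?F" for m
  proof -
    have "q ^ k * m < q ^ (2 * L)"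
      using that by (simp add: residual_def Y_def)
    moreover have "q ^ L * m \<le> q ^ k * m"
      using Lk q_pos by (intro mult_le_mono1 power_increasing) simp_all
    ultimately have "q ^ L * m < q ^ L * q ^ L"
      unfolding mult_2 power_add by linarith
    then show ?thesis by (metis mult_less_cancel1)
  qed
  show ?thesis
  proof (cases "?F = {} \<or> (\<exists>m. ?F = {m})")
    case True
    then show ?thesis using elem that(1,2) by blast
  next
    case False
    then obtain m n where "m \<in> ?F" "n \<in> ?F" "m \<noteq> n" by blast
    then obtain m n where mn: "m \<in> ?F" "n \<in> ?F" "m < n" by (metis linorder_neqE_nat)
    obtain r where r: "a + q ^ k * m = r ^ 2"
      using mn(1) by (auto simp: residual_def Y_def elim: is_nth_powerE)
    obtain s where s: "a + q ^ k * n = s ^ 2" "s ^ 2 < q ^ (2 * L)"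
      using mn(2) by (auto simp: residual_def Y_def elim!: is_nth_powerE)
    have "r ^ 2 < s ^ 2" using mn(3) q_pos by (simp flip: r s(1))
    then have rs: "r < s" by (rule power_less_imp_less_base) simp
    have "s ^ 2 < (q ^ L) ^ 2"
      using s(2) by (simp add: mult.commute flip: power_mult)
    then have sL: "s < q ^ L" by (rule power_less_imp_less_base) simp
    have "s ^ 2 - r ^ 2 = q ^ k * (n - m)"
      by (simp add: diff_mult_distrib2 flip: r s(1))
    then have "q ^ (k - L) dvd s"
      using congruent_squares_dvd[OF q rs sL] Lk by simp
    then obtain u where u: "s = q ^ (k - L) * u" by blast
    \<comment> \<open>A positive multiple of \<open>q ^ (k - L)\<close> below \<open>q ^ L\<close>
      forces \<open>k < 2 * L\<close>.\<close>
    have u_pos: "u > 0" using u rs by (cases u) auto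
    have "q ^ (k - L) \<le> s" unfolding u using u_pos by simp
    then have "q ^ (k - L) < q ^ L" using sL by linarith
    then have kL: "k - L < L"
      by (rule power_less_imp_less_exp[rotated]) (use prime_gt_1_nat[OF q(1)] in simp)
    \<comment> \<open>With this \<open>i\<close>, \<open>s = q ^ (L - i) * u < q ^ L\<close> says
      exactly \<open>u < q ^ i\<close>. As \<open>a < q ^ k\<close>, it is the remainder of
      \<open>s ^ 2\<close> modulo \<open>q ^ k\<close>.\<close>
    define i where "i = 2 * L - k"
    have i: "i \<le> L" "L - i = k - L" "2 * L - i = k" using kL Lk by (auto simp: i_def)
    have "q ^ (k - L) * u < q ^ (k - L) * q ^ i"
      using sL i kL Lk by (simp add: u i_def flip: power_add)
    then have "u < q ^ i" by simp
    moreover have "a = (q ^ (L - i) * u) ^ 2 mod q ^ (2 * L - i)"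
      using a by (simp add: i flip: u s(1))
    ultimately show ?thesis using that(3) i by metis
  qed
qed

lemma automaticity_squares_le:
  fixes q L :: nat
  assumes q: "prime q" "odd q" and x: "x < real q ^ (2 * L)"
  shows "automaticity q {n. 0 < n \<and> is_square n} x \<le> 6 * q ^ L"
proof -
  have q2: "q \<ge> 2" using q(1) by (rule prime_ge_2_nat)
  \<comment> \<open>\<open>Y\<close> also contains 0, but recognition is tested only from 1 on.
    Below, \<open>A\<close> covers the residuals with \<open>k \<le> L\<close>, \<open>B\<close> the
    singletons and \<open>C\<close> those with at least two elements when
    \<open>k > L\<close>.\<close>
  define Y where "Y = {n::nat. is_square n \<and> n < q ^ (2 * L)}"
  define A where "A = (\<Union>i\<le>L. residual q Y i ` {..<q ^ i})"
  define B where "B = (\<lambda>m. {m}) ` {..<q ^ L}"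
  define C where "C = (\<Union>i\<le>L. (\<lambda>u. residual q Y (2 * L - i)
      ((q ^ (L - i) * u) ^ 2 mod q ^ (2 * L - i))) ` {..<q ^ i})"
  define T where "T = insert {} (A \<union> B \<union> C)"
  have fin: "finite A" "finite B" "finite C" by (auto simp: A_def B_def C_def)
  have "automaticity q {n. 0 < n \<and> is_square n} x \<le> card T"
  proof (rule automaticity_le_card_residuals[OF q2, where Y = Y])
    show "finite T" using fin by (simp add: T_def)
    show "residual q Y k a \<in> T" if a: "a < q ^ k" for k a
    proof (cases "k \<le> L")
      case True
      then show ?thesis using a by (auto simp: T_def A_def)
    next
      case False
      then have "L < k" by simp
      from q this a show ?thesis
      proof (rule residual_squares_cases, fold Y_def)
        assume "residual q Y k a = {}"
        then show ?thesis by (simp add: T_def)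
      next
        fix m assume "m < q ^ L" "residual q Y k a = {m}"
        then show ?thesis by (simp add: T_def B_def)
      next
        fix i u assume "i \<le> L" "u < q ^ i" "residual q Y k a =
          residual q Y (2 * L - i) ((q ^ (L - i) * u) ^ 2 mod q ^ (2 * L - i))"
        then have "residual q Y k a \<in> C" unfolding C_def by blast
        then show ?thesis by (simp add: T_def)
      qed
    qed
    fix n :: nat
    assume "1 \<le> n" "real n \<le> x"
    moreover from this have "real n < real q ^ (2 * L)" using x by linarith
    then have "n < q ^ (2 * L)" by (metis of_nat_less_iff of_nat_power)
    ultimately show "n \<in> {n. 0 < n \<and> is_square n} \<longleftrightarrow> n \<in> Y"
      by (simp add: Y_def)
  qed
  also have "card T \<le> 1 + (card A + card B + card C)"
    unfolding T_def using card_Un_le[of A B] card_Un_le[of "A \<union> B" C]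
      fin by (simp add: card_insert_if)
  also have "\<dots> \<le> 1 + (2 * q ^ L + q ^ L + 2 * q ^ L)"
  proof -
    have "card A \<le> 2 * q ^ L" "card C \<le> 2 * q ^ L"
      unfolding A_def C_def by (rule card_UN_powers_le[OF q2])+
    moreover have "card B \<le> q ^ L"
      unfolding B_def by (metis card_image_le card_lessThan finite_lessThan)
    ultimately show ?thesis by linarith
  qed
  also have "\<dots> \<le> 6 * q ^ L" using q2 by simp
  finally show ?thesis .
qed

section \<open>From powers of \<open>q\<close> to all large \<open>x\<close>\<close>

theorem theorem2:
  fixes q :: nat
  assumes "prime q" and "odd q"
  shows "\<exists>c1 c2 :: real. 0 < c1 \<and> c1 \<le> c2 \<and>
           (\<forall>\<^sub>F x :: real in at_top.
              c1 * x powr (1/2) \<le> real (automaticity q {n. 0 < n \<and> is_square n} x) \<and>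
              real (automaticity q {n. 0 < n \<and> is_square n} x) \<le> c2 * x powr (1/2))"
proof -
  have q3: "q \<ge> 3"
    using assms prime_ge_2_nat[of q] by (cases "q = 2") auto
  let ?A = "\<lambda>x. real (automaticity q {n. 0 < n \<and> is_square n} x)"
  \<comment> \<open>For \<open>q ^ L \<le> sqrt x < q ^ (L + 1)\<close>, the lower bound
    \<open>q ^ (L - 1) / 3\<close> loses a factor \<open>q ^ 2\<close> against
    \<open>sqrt x\<close>, and the upper bound \<open>6 * q ^ (L + 1)\<close> loses a factor
    \<open>q\<close>.\<close>
  have bounds: "1 / (3 * q ^ 2) * x powr (1/2) \<le> ?A x \<and> ?A x \<le> 6 * q * x powr (1/2)"
    if x: "x \<ge> real q ^ 4" for x :: real
  proof -
    have "real q ^ 4 > 0" using q3 by simp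
    then have x_pos: "x > 0" using x by linarith
    then have sqrt: "x powr (1/2) = sqrt x" by (simp add: powr_half_sqrt)
    have sqrt_ge: "real q ^ 2 \<le> sqrt x"
      using x by (intro real_le_rsqrt) simp
    define m where "m = nat \<lfloor>sqrt x\<rfloor>"
    have m_ge: "q ^ 2 \<le> m"
      using sqrt_ge by (simp add: m_def le_nat_floor)
    moreover have "q ^ 2 > 0" using q3 by simp
    ultimately have "m \<ge> 1" by linarith
    then obtain L where L: "q ^ L \<le> m" "m < q ^ (L + 1)"
      using ex_power_ivl1[of q m] q3 by auto
    \<comment> \<open>The threshold \<open>q ^ 4\<close> ensures \<open>L \<ge> 2\<close>, as the
      exponent \<open>l + 2\<close> in the lower bound requires.\<close>
    have "q ^ 2 < q ^ (L + 1)" using m_ge L(2) by linarith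
    then have "2 < L + 1" by (rule power_less_imp_less_exp[rotated]) (use q3 in simp)
    then obtain l where l: "L = l + 2" by (metis Suc_eq_plus1 less_Suc_eq_le le_Suc_ex add.commute)
    have m: "real m \<le> sqrt x" "sqrt x < real m + 1"
      unfolding m_def using x_pos by (simp, linarith)
    have "real (q ^ L) \<le> real m" using L(1) by (simp only: of_nat_le_iff)
    then have low: "real q ^ L \<le> sqrt x" using m unfolding of_nat_power by linarith
    have "real (m + 1) \<le> real (q ^ (L + 1))" using L(2) by (subst of_nat_le_iff) simp
    then have high: "sqrt x < real q ^ (L + 1)" using m by simp
    have x_eq: "x = sqrt x ^ 2" using x_pos by simp
    have "(real q ^ L) ^ 2 \<le> sqrt x ^ 2" using low by (rule power_mono) simp
    then have "real q ^ (2 * L) \<le> x" using x_eq by (simp add: mult.commute flip: power_mult)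
    then have "q ^ (l + 1) \<le> 3 * automaticity q {n. 0 < n \<and> is_square n} x"
      using automaticity_squares_ge[OF assms(2) q3] l by simp
    then have "real (q ^ (l + 1)) \<le> real (3 * automaticity q {n. 0 < n \<and> is_square n} x)"
      by (simp only: of_nat_le_iff)
    then have ge: "real q ^ (l + 1) \<le> 3 * ?A x" by simp
    have "sqrt x \<le> real q ^ 2 * real q ^ (l + 1)"
      using high by (simp add: l power2_eq_square mult_ac)
    also have "\<dots> \<le> real q ^ 2 * (3 * ?A x)" using ge by (intro mult_left_mono) simp_all
    finally have lower: "1 / (3 * q ^ 2) * sqrt x \<le> ?A x"
      using q3 by (simp add: field_simps)
    have "sqrt x ^ 2 < (real q ^ (L + 1)) ^ 2"
      using high x_pos by (intro power_strict_mono) simp_all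
    then have "x < real q ^ (2 * (L + 1))"
      using x_eq by (simp add: mult.commute del: power_Suc flip: power_mult)
    then have "automaticity q {n. 0 < n \<and> is_square n} x \<le> 6 * q ^ (L + 1)"
      by (rule automaticity_squares_le[OF assms])
    then have "?A x \<le> real (6 * q ^ (L + 1))" by (simp only: of_nat_le_iff)
    also have "\<dots> = 6 * q * real q ^ L" by simp
    also have "\<dots> \<le> 6 * q * sqrt x" using low by (intro mult_left_mono) simp_all
    finally show ?thesis using lower by (simp add: sqrt)
  qed
  have q1: "real q \<ge> 1" using q3 by simp
  have "1 / (3 * real q ^ 2) \<le> 1"
    using one_le_power[OF q1, of 2] by (simp add: divide_le_eq)
  then have "1 / (3 * real q ^ 2) \<le> 6 * real q" using q1 by linarith
  moreover have "0 < 1 / (3 * real q ^ 2)" using q1 by simp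
  moreover have "\<forall>\<^sub>F x in at_top. 1 / (3 * real q ^ 2) * x powr (1/2) \<le> ?A x \<and>
      ?A x \<le> 6 * real q * x powr (1/2)"
    using eventually_ge_at_top[of "real q ^ 4"] by eventually_elim (use bounds in simp)
  ultimately show ?thesis by blast
qed

end
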